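(* Let $A=P-R+S$ be a double weak splitting of type II of a symmetric nonsingular matrix $A\in\mathbb{R}^{n\times n}$, and let $$\widetilde{\mathbf{W}}=\begin{pmatrix}(RP^{-1})^T & -(SP^{-1})^T\\ I & 0\end{pmatrix}.$$ Then $\rho(\widetilde{\mathbf{W}})<1$ if and only if $\rho((R-S)P^{-1})=\rho(P^{-1}(R-S))<1$.
   Context: Matrix inequalities are entrywise; $\rho$ is the spectral radius; $I$ is the $n\times n$ identity. For a symmetric nonsingular matrix $A\in\mathbb{R}^{n\times n}$, a decomposition $A=P-R+S$ with $P$ nonsingular is a double weak splitting of type II if $RP^{-1}\ge 0$ and $-SP^{-1}\ge 0$. *)

theory Defs
  imports
    "Jordan_Normal_Form.Gauss_Jordan_Elimination"
    "Jordan_Normal_Form.Spectral_Radius"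
begin

text \<open>The eigenvalues of a real matrix are taken over the complex numbers.\<close>

definition rho :: "real mat \<Rightarrow> real" where
  "rho M = spectral_radius (map_mat complex_of_real M)"

text \<open>Only meaningful for invertible \<open>M\<close>; otherwise the value is unspecified.\<close>

definition minv :: "real mat \<Rightarrow> real mat" where
  "minv M = the (mat_inverse M)"

lemma minv:
  assumes M: "M \<in> carrier_mat n n" and inv: "invertible_mat M"
  shows "minv M \<in> carrier_mat n n" "M * minv M = 1\<^sub>m n" "minv M * M = 1\<^sub>m n"
proof -
  from inv obtain B where B: "M * B = 1\<^sub>m n" "B * M = 1\<^sub>m (dim_row B)"
    using M unfolding invertible_mat_def inverts_mat_def by auto
  have "dim_col B = n" using arg_cong[OF B(1), of dim_col] by simp
  moreover have "dim_row B = n" using arg_cong[OF B(2), of dim_col] M by simp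
  ultimately have "B \<in> carrier_mat n n" by auto
  then have "M \<in> Units (ring_mat TYPE(real) n b)" for b :: unit
    using M B by (auto simp: Units_def ring_mat_def)
  then obtain C where C: "mat_inverse M = Some C"
    using mat_inverse(1)[OF M, of "()"] by (cases "mat_inverse M") auto
  show "minv M \<in> carrier_mat n n" "M * minv M = 1\<^sub>m n" "minv M * M = 1\<^sub>m n"
    using mat_inverse(2)[OF M C] C by (auto simp: minv_def)
qed

text \<open>The order on matrices is the entrywise one.\<close>

definition double_weak_splitting_II ::
  "nat \<Rightarrow> real mat \<Rightarrow> real mat \<Rightarrow> real mat \<Rightarrow> real mat \<Rightarrow> bool" where
  "double_weak_splitting_II n A P R S \<longleftrightarrow>
     P \<in> carrier_mat n n \<and> R \<in> carrier_mat n n \<and> S \<in> carrier_mat n n \<and>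
     A = P - R + S \<and> invertible_mat P \<and>
     0\<^sub>m n n \<le> R * minv P \<and> 0\<^sub>m n n \<le> - S * minv P"

definition W_tilde :: "nat \<Rightarrow> real mat \<Rightarrow> real mat \<Rightarrow> real mat \<Rightarrow> real mat" where
  "W_tilde n P R S =
     four_block_mat (transpose_mat (R * minv P)) (- transpose_mat (S * minv P))
                    (1\<^sub>m n)                      (0\<^sub>m n n)"

end

theory Submission
  imports Defs
begin

text \<open>
  A nonnegative matrix \<open>M\<close> has \<open>\<rho>(M) < 1\<close> if and only if \<open>M x < x\<close> for some positive vector \<open>x\<close>:
  a truncated Neumann series applied to the all-ones vector is such an \<open>x\<close>.
  Let \<open>B\<close> and \<open>C\<close> be the upper blocks of the block matrix. If \<open>(u, v)\<close> is such a vector for it,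
  then \<open>u < v\<close> and \<open>B u + C v < u\<close>, so \<open>(B + C) u < u\<close>; conversely, \<open>(B + C) u < u\<close>
  makes \<open>(u, (1 + \<epsilon>) u)\<close> such a vector for small \<open>\<epsilon> > 0\<close>. Here \<open>B + C\<close> is the
  transpose of \<open>(R - S) P\<^sup>-\<^sup>1\<close>, and this matrix is similar to \<open>P\<^sup>-\<^sup>1 (R - S)\<close>.
\<close>

section \<open>Spectral radius, characteristic polynomial and eigenvalues\<close>

text \<open>The complex spectrum is the root set of the characteristic polynomial. This covers both
  transposition and similarity.\<close>

lemma rho_cong_char_poly:
  assumes "M \<in> carrier_mat n n" "N \<in> carrier_mat n n" "char_poly M = char_poly N"
  shows "rho M = rho N"
proof -
  have "char_poly (map_mat complex_of_real M) = char_poly (map_mat complex_of_real N)"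
    using assms by (simp add: of_real_hom.char_poly_hom[of _ n])
  moreover have "spectrum (map_mat complex_of_real X) =
      {k. poly (char_poly (map_mat complex_of_real X)) k = 0}"
    if "X \<in> carrier_mat n n" for X
    using that by (intro spectrum_root_char_poly[of _ n]) simp
  ultimately show ?thesis
    using assms(1,2) by (simp add: rho_def spectral_radius_def)
qed

lemma rho_transpose:
  assumes "M \<in> carrier_mat n n"
  shows "rho (transpose_mat M) = rho M"
  using assms by (intro rho_cong_char_poly[of _ n]) auto

lemma norm_eigenvalue_le_rho:
  assumes "M \<in> carrier_mat n n" "n > 0" "eigenvalue (map_mat complex_of_real M) l"
  shows "norm l \<le> rho M"
  using assms spectral_radius_mem_max(2)[of "map_mat complex_of_real M" n "norm l"]
  by (auto simp: rho_def spectrum_def)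

lemma rho_attained:
  assumes "M \<in> carrier_mat n n" "n > 0"
  obtains l where "eigenvalue (map_mat complex_of_real M) l" "norm l = rho M"
  using assms spectral_radius_mem_max(1)[of "map_mat complex_of_real M" n]
  by (auto simp: rho_def spectrum_def)

section \<open>Matrix powers and their geometric decay\<close>

lemma mult_mat_vec_index:
  assumes "M \<in> carrier_mat n n" "v \<in> carrier_vec n" "i < n"
  shows "(M *\<^sub>v v) $ i = (\<Sum>j<n. M $$ (i, j) * v $ j)"
  using assms by (auto simp: scalar_prod_def lessThan_atLeast0 intro!: sum.cong)

lemma pow_mat_Suc_left:
  fixes M :: "'a::semiring_1 mat"
  assumes M: "M \<in> carrier_mat n n"
  shows "M ^\<^sub>m Suc k = M * M ^\<^sub>m k"
proof (induction k)
  case (Suc k)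
  have "M ^\<^sub>m Suc (Suc k) = (M * M ^\<^sub>m k) * M"
    using Suc.IH by simp
  also have "\<dots> = M * M ^\<^sub>m Suc k"
    using M by (simp add: assoc_mult_mat[of _ n n _ n _ n])
  finally show ?case .
qed (use M in simp)

lemma pow_mat_smult:
  fixes M :: "'a::comm_ring_1 mat"
  assumes M: "M \<in> carrier_mat n n"
  shows "(s \<cdot>\<^sub>m M) ^\<^sub>m k = s ^ k \<cdot>\<^sub>m M ^\<^sub>m k"
proof (induction k)
  case 0
  show ?case by (rule eq_matI) auto
next
  case (Suc k)
  have "M ^\<^sub>m k \<in> carrier_mat n n" using M by simp
  then show ?case using M Suc
    by (auto simp: mult_smult_distrib[of _ n n _ n] mult_smult_assoc_mat[of _ n n _ n]
        intro!: eq_matI)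
qed

text \<open>Dividing \<open>M\<close> by a number \<open>t\<close> strictly between its spectral
  radius and 1 leaves the radius below 1. The powers of the scaled matrix are then bounded by a
  constant \<open>c\<close>, and undoing the scaling gives the factor \<open>t ^ k\<close>.\<close>

lemma rho_less_1_pow_bound:
  assumes M: "M \<in> carrier_mat n n" and n: "n > 0" and r: "rho M < 1"
  obtains t c where "0 < t" "t < 1"
    "\<And>k i j. i < n \<Longrightarrow> j < n \<Longrightarrow> \<bar>(M ^\<^sub>m k) $$ (i, j)\<bar> \<le> c * t ^ k"
proof -
  \<comment> \<open>The midpoint of \<open>max 0 (rho M)\<close> and 1; the maximum with 0 makes
    \<open>t\<close> positive, so dividing by it is safe.\<close>
  define t where "t = (1 + max 0 (rho M)) / 2"
  have t: "0 < t" "t < 1" "rho M < t" using r by (auto simp: t_def max_def)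
  define N where "N = complex_of_real (1 / t) \<cdot>\<^sub>m map_mat complex_of_real M"
  have N: "N \<in> carrier_mat n n" using M by (simp add: N_def)
  have "spectral_radius N < 1"
  proof -
    \<comment> \<open>An eigenvalue \<open>l\<close> of \<open>N\<close> of maximal modulus gives
      the eigenvalue \<open>t * l\<close> of \<open>M\<close>, whence
      \<open>t * norm l \<le> rho M < t\<close>.\<close>
    obtain l where l: "eigenvalue N l" "norm l = spectral_radius N"
      using spectral_radius_mem_max(1)[OF N n] by (auto simp: spectrum_def)
    then obtain v where v: "v \<in> carrier_vec n" "v \<noteq> 0\<^sub>v n" "N *\<^sub>v v = l \<cdot>\<^sub>v v"
      using N by (auto simp: eigenvalue_def eigenvector_def)
    have "map_mat complex_of_real M = complex_of_real t \<cdot>\<^sub>m N"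
      using t by (auto simp: N_def intro!: eq_matI)
    then have "map_mat complex_of_real M *\<^sub>v v = complex_of_real t \<cdot>\<^sub>v (N *\<^sub>v v)"
      using N v(1) by auto
    then have "eigenvalue (map_mat complex_of_real M) (complex_of_real t * l)"
      using v M by (auto simp: eigenvalue_def eigenvector_def smult_smult_assoc)
    then have "t * norm l \<le> rho M"
      using norm_eigenvalue_le_rho[OF M n] t by (fastforce simp: norm_mult)
    then have "t * norm l < t" using t by linarith
    then show ?thesis using t l(2) by simp
  qed
  then obtain c where c: "\<And>k. norm_bound (N ^\<^sub>m k) c"
    using spectral_radius_jnf_norm_bound_less_1_upper_triangular[OF N] by blast
  have "\<bar>(M ^\<^sub>m k) $$ (i, j)\<bar> \<le> c * t ^ k" if ij: "i < n" "j < n" for k i j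
  proof -
    have "N ^\<^sub>m k = complex_of_real (1 / t) ^ k \<cdot>\<^sub>m map_mat complex_of_real (M ^\<^sub>m k)"
      using M unfolding N_def
      by (simp add: pow_mat_smult[of _ n] of_real_hom.mat_hom_pow[OF M])
    then have eq: "norm ((N ^\<^sub>m k) $$ (i, j)) = (1 / t) ^ k * \<bar>(M ^\<^sub>m k) $$ (i, j)\<bar>"
      using ij M t pow_carrier_mat[OF M, of k]
      by (simp add: norm_mult norm_power norm_divide del: pow_carrier_mat)
    have "norm ((N ^\<^sub>m k) $$ (i, j)) \<le> c"
      using c[of k] ij N by (auto simp: norm_bound_def)
    then show ?thesis unfolding eq using t by (simp add: field_simps)
  qed
  with t(1,2) show ?thesis by (rule that)
qed

section \<open>The positive-vector criterion for nonnegative matrices\<close>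

lemma nonneg_rho_less_1_iff:
  assumes M: "M \<in> carrier_mat n n" and n: "n > 0"
    and nonneg: "\<And>i j. i < n \<Longrightarrow> j < n \<Longrightarrow> 0 \<le> M $$ (i, j)"
  shows "rho M < 1 \<longleftrightarrow>
    (\<exists>x \<in> carrier_vec n. \<forall>i<n. 0 < x $ i \<and> (M *\<^sub>v x) $ i < x $ i)"
proof
  assume "rho M < 1"
  then obtain t c where t: "0 < t" "t < 1" and
    c: "\<And>k i j. i < n \<Longrightarrow> j < n \<Longrightarrow> \<bar>(M ^\<^sub>m k) $$ (i, j)\<bar> \<le> c * t ^ k"
    using rho_less_1_pow_bound[OF M n] by metis
  define y where "y k = M ^\<^sub>m k *\<^sub>v vec n (\<lambda>_. 1)" for k
  have y: "y k \<in> carrier_vec n" for k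
    unfolding y_def by (intro mult_mat_vec_carrier[of _ n n] pow_carrier_mat M vec_carrier)
  have y_Suc: "y (Suc k) = M *\<^sub>v y k" for k
    unfolding y_def pow_mat_Suc_left[OF M] using M
    by (intro assoc_mult_mat_vec[of _ n n _ n]) auto
  have y_0: "y 0 $ i = 1" if "i < n" for i using that M by (simp add: y_def)
  have y_nonneg: "0 \<le> y k $ i" if "i < n" for k i
    using that
  proof (induction k arbitrary: i)
    case (Suc k)
    then show ?case unfolding y_Suc mult_mat_vec_index[OF M y Suc.prems]
      by (intro sum_nonneg mult_nonneg_nonneg nonneg) auto
  qed (simp add: y_0)
  have y_bound: "y k $ i \<le> real n * c * t ^ k" if i: "i < n" for k i
  proof -
    have "y k $ i = (\<Sum>j<n. (M ^\<^sub>m k) $$ (i, j))"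
      unfolding y_def using i M by (subst mult_mat_vec_index[of _ n]) auto
    also have "\<dots> \<le> (\<Sum>j<n. c * t ^ k)"
      using c[OF i] by (intro sum_mono) (smt (verit) lessThan_iff)
    finally show ?thesis by simp
  qed
  \<comment> \<open>The bound on the entries of \<open>y k\<close> does not depend on the row, so a
    single \<open>K\<close> brings all entries of \<open>y K\<close> below 1.\<close>
  have "(\<lambda>k. real n * c * t ^ k) \<longlonglongrightarrow> real n * c * 0"
    using t by (intro tendsto_intros LIMSEQ_realpow_zero) auto
  then have "eventually (\<lambda>k. real n * c * t ^ k < 1) sequentially"
    by (intro order_tendstoD(2)) auto
  then obtain K where "real n * c * t ^ K < 1"
    by (auto simp: eventually_sequentially)
  then have y_K: "y K $ i < 1" if "i < n" for i
    using y_bound[OF that, of K] by simp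
  \<comment> \<open>All entries of \<open>y 0\<close> are 1, which excludes \<open>K = 0\<close>.
    Hence the sum defining \<open>x\<close> contains \<open>y 0\<close>, and this makes it
    positive.\<close>
  have "K \<noteq> 0" using y_0[OF n] y_K[OF n] by (intro notI) simp
  define x where "x = vec n (\<lambda>i. \<Sum>k<K. y k $ i)"
  have x: "x \<in> carrier_vec n" by (simp add: x_def)
  have "0 < x $ i \<and> (M *\<^sub>v x) $ i < x $ i" if i: "i < n" for i
  proof
    show "0 < x $ i"
      using i \<open>K \<noteq> 0\<close> y_0[OF i] y_nonneg[OF i]
      by (auto simp: x_def intro!: sum_pos2[of _ 0])
    have "(M *\<^sub>v x) $ i = (\<Sum>j<n. \<Sum>k<K. M $$ (i, j) * y k $ j)"
      unfolding mult_mat_vec_index[OF M x i] by (simp add: x_def sum_distrib_left)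
    also have "\<dots> = (\<Sum>k<K. y (Suc k) $ i)"
      unfolding y_Suc mult_mat_vec_index[OF M y i] by (rule sum.swap)
    \<comment> \<open>Shifting the index changes only the two end terms: \<open>y 0\<close> drops
      out and the smaller \<open>y K\<close> comes in.\<close>
    also have "\<dots> = x $ i - y 0 $ i + y K $ i"
      using i sum.lessThan_Suc_shift[of "\<lambda>k. y k $ i" K] by (simp add: x_def)
    also have "\<dots> < x $ i" using y_0[OF i] y_K[OF i] by simp
    finally show "(M *\<^sub>v x) $ i < x $ i" .
  qed
  with x show "\<exists>x \<in> carrier_vec n. \<forall>i<n. 0 < x $ i \<and> (M *\<^sub>v x) $ i < x $ i" by blast
next
  text \<open>An eigenvector is estimated in the weighted maximum norm given by \<open>x\<close>.\<close>
  assume "\<exists>x \<in> carrier_vec n. \<forall>i<n. 0 < x $ i \<and> (M *\<^sub>v x) $ i < x $ i"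
  then obtain x where x: "x \<in> carrier_vec n"
    and x_pos: "\<And>i. i < n \<Longrightarrow> 0 < x $ i" and Mx: "\<And>i. i < n \<Longrightarrow> (M *\<^sub>v x) $ i < x $ i"
    by blast
  obtain l where l: "eigenvalue (map_mat complex_of_real M) l" "norm l = rho M"
    using rho_attained[OF M n] by blast
  obtain v where v: "v \<in> carrier_vec n" "v \<noteq> 0\<^sub>v n"
    and ev: "map_mat complex_of_real M *\<^sub>v v = l \<cdot>\<^sub>v v"
    using l(1) M by (auto simp: eigenvalue_def eigenvector_def)
  define q where "q i = norm (v $ i) / x $ i" for i
  have "finite (q ` {..<n})" "q ` {..<n} \<noteq> {}" using n by auto
  \<comment> \<open>At the maximizing row \<open>m\<close> the bound \<open>v_le\<close> is an
    equality, so row \<open>m\<close> of the eigenvalue equation compares \<open>norm l\<close> with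
    1.\<close>
  from Max_in[OF this] obtain m where m: "m < n" "Max (q ` {..<n}) = q m" by auto
  have v_le: "norm (v $ j) \<le> q m * x $ j" if "j < n" for j
  proof -
    have "q j \<le> q m" using that m(2)[symmetric] by simp
    then show ?thesis using x_pos[OF that] by (simp add: q_def divide_le_eq)
  qed
  obtain i where "i < n" "v $ i \<noteq> 0" using v by (metis eq_vecI carrier_vecD index_zero_vec)
  then have "0 < q m * x $ i" using v_le[of i] by (smt (verit) zero_less_norm_iff)
  then have "0 < q m" using x_pos[OF \<open>i < n\<close>] by (simp add: zero_less_mult_iff)
  have "norm l * (q m * x $ m) = norm ((l \<cdot>\<^sub>v v) $ m)"
    using m(1) v(1) x_pos[OF m(1)] by (simp add: q_def norm_mult)
  also have "\<dots> = norm (\<Sum>j<n. complex_of_real (M $$ (m, j)) * v $ j)"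
    unfolding ev[symmetric] using M v(1) m(1) by (subst mult_mat_vec_index[of _ n]) auto
  also have "\<dots> \<le> (\<Sum>j<n. M $$ (m, j) * norm (v $ j))"
    by (rule sum_norm_le) (use nonneg m(1) in \<open>auto simp: norm_mult\<close>)
  also have "\<dots> \<le> (\<Sum>j<n. M $$ (m, j) * (q m * x $ j))"
    using nonneg m(1) v_le by (intro sum_mono mult_left_mono) auto
  also have "\<dots> = q m * (M *\<^sub>v x) $ m"
    unfolding mult_mat_vec_index[OF M x m(1)] by (simp add: sum_distrib_left mult_ac)
  also have "\<dots> < 1 * (q m * x $ m)" using Mx[OF m(1)] \<open>0 < q m\<close> by simp
  finally have "norm l < 1"
    using \<open>0 < q m\<close> x_pos[OF m(1)] by (simp add: mult_less_cancel_right)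
  then show "rho M < 1" using l(2) by simp
qed

section \<open>Reduction of the block matrix to the sum of its upper blocks\<close>

lemma rho_block_companion_less_1_iff:
  assumes B: "B \<in> carrier_mat n n" and C: "C \<in> carrier_mat n n" and n: "n > 0"
    and B_nonneg: "\<And>i j. i < n \<Longrightarrow> j < n \<Longrightarrow> 0 \<le> B $$ (i, j)"
    and C_nonneg: "\<And>i j. i < n \<Longrightarrow> j < n \<Longrightarrow> 0 \<le> C $$ (i, j)"
  shows "rho (four_block_mat B C (1\<^sub>m n) (0\<^sub>m n n)) < 1 \<longleftrightarrow> rho (B + C) < 1"
proof -
  define W where "W = four_block_mat B C (1\<^sub>m n) (0\<^sub>m n n)"
  have W: "W \<in> carrier_mat (n + n) (n + n)"
    unfolding W_def using B by (intro four_block_carrier_mat) auto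
  have W_nonneg: "0 \<le> W $$ (i, j)" if "i < n + n" "j < n + n" for i j
    using that B C B_nonneg C_nonneg by (auto simp: W_def)
  have BC: "B + C \<in> carrier_mat n n" using B C by simp
  have BC_nonneg: "0 \<le> (B + C) $$ (i, j)" if "i < n" "j < n" for i j
    using that B C B_nonneg C_nonneg by simp
  have W_mult: "W *\<^sub>v (u @\<^sub>v v) = (B *\<^sub>v u + C *\<^sub>v v) @\<^sub>v u"
    if "u \<in> carrier_vec n" "v \<in> carrier_vec n" for u v
    unfolding W_def using that B C by (subst four_block_mat_mult_vec[of _ n n _ n _ n]) auto
  have BC_mult: "((B + C) *\<^sub>v u) $ i = (B *\<^sub>v u) $ i + (C *\<^sub>v u) $ i"
    if "u \<in> carrier_vec n" "i < n" for u i
    using that B C by (subst add_mult_distrib_mat_vec[of _ n n]) auto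
  have "rho W < 1 \<longleftrightarrow> rho (B + C) < 1"
    \<comment> \<open>Only the side of \<open>B + C\<close> is rewritten here; for \<open>W\<close>
      the criterion is applied within each direction, in dimension \<open>n + n\<close>.\<close>
    unfolding nonneg_rho_less_1_iff[OF BC n BC_nonneg, simplified]
  proof
    assume "rho W < 1"
    then obtain x where x: "x \<in> carrier_vec (n + n)"
      and Wx: "\<And>i. i < n + n \<Longrightarrow> 0 < x $ i \<and> (W *\<^sub>v x) $ i < x $ i"
      using nonneg_rho_less_1_iff[OF W _ W_nonneg] n by auto
    define u v where "u = vec_first x n" and "v = vec_last x n"
    have u: "u \<in> carrier_vec n" and v: "v \<in> carrier_vec n" and xuv: "x = u @\<^sub>v v"
      using x by (simp_all add: u_def v_def)
    \<comment> \<open>The lower half of \<open>W\<close> applied to \<open>u\<close> and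
      \<open>v\<close> is \<open>u\<close> itself, so the lower rows of the inequality compare
      \<open>u\<close> with \<open>v\<close>.\<close>
    have u_less: "u $ i < v $ i" if "i < n" for i
      using Wx[of "n + i"] that u v B C unfolding xuv W_mult[OF u v] by simp
    have "0 < u $ i \<and> ((B + C) *\<^sub>v u) $ i < u $ i" if i: "i < n" for i
    proof -
      have "0 < u $ i" "(B *\<^sub>v u) $ i + (C *\<^sub>v v) $ i < u $ i"
        using Wx[of i] i u v B C unfolding xuv W_mult[OF u v] by simp_all
      moreover have "(C *\<^sub>v u) $ i \<le> (C *\<^sub>v v) $ i"
        unfolding mult_mat_vec_index[OF C u i] mult_mat_vec_index[OF C v i]
        using u_less C_nonneg[OF i] by (intro sum_mono mult_left_mono) (auto intro: less_imp_le)
      ultimately show ?thesis using BC_mult[OF u i] by simp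
    qed
    with u show "\<exists>x\<in>carrier_vec n. \<forall>i<n. 0 < x $ i \<and> ((B + C) *\<^sub>v x) $ i < x $ i" by blast
  next
    assume "\<exists>x\<in>carrier_vec n. \<forall>i<n. 0 < x $ i \<and> ((B + C) *\<^sub>v x) $ i < x $ i"
    then obtain u where u: "u \<in> carrier_vec n" and u_pos: "\<And>i. i < n \<Longrightarrow> 0 < u $ i"
      and BCu: "\<And>i. i < n \<Longrightarrow> ((B + C) *\<^sub>v u) $ i < u $ i" by blast
    \<comment> \<open>The strict inequality at \<open>e = 0\<close> persists for small positive
      \<open>e\<close> by continuity, and finitely many rows admit a common
      \<open>e\<close>.\<close>
    have "eventually (\<lambda>e. ((B + C) *\<^sub>v u) $ i + e * (C *\<^sub>v u) $ i < u $ i) (at_right 0)"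
      if "i < n" for i
      by (rule order_tendstoD(2)[of _ "((B + C) *\<^sub>v u) $ i + 0 * (C *\<^sub>v u) $ i"])
        (use BCu[OF that] in \<open>auto intro!: tendsto_eq_intros\<close>)
    then have "eventually (\<lambda>e. \<forall>i\<in>{..<n}. ((B + C) *\<^sub>v u) $ i + e * (C *\<^sub>v u) $ i < u $ i)
        (at_right (0::real))"
      by (intro eventually_ball_finite) auto
    then have "eventually (\<lambda>e. e > 0 \<and> (\<forall>i\<in>{..<n}. ((B + C) *\<^sub>v u) $ i + e * (C *\<^sub>v u) $ i < u $ i))
        (at_right (0::real))"
      by (rule eventually_conj[OF eventually_at_right_less])
    then have "\<exists>e>0. \<forall>i\<in>{..<n}. ((B + C) *\<^sub>v u) $ i + e * (C *\<^sub>v u) $ i < u $ i"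
      by (rule eventually_happens'[OF trivial_limit_at_right_real])
    then obtain e where "e > 0"
      and e: "\<And>i. i < n \<Longrightarrow> ((B + C) *\<^sub>v u) $ i + e * (C *\<^sub>v u) $ i < u $ i"
      by (metis lessThan_iff)
    \<comment> \<open>The factor \<open>1 + e\<close> makes the lower rows strict, and it adds to
      the upper rows exactly the term \<open>e * (C *\<^sub>v u) $ i\<close> controlled by
      \<open>e\<close>.\<close>
    define v where "v = (1 + e) \<cdot>\<^sub>v u"
    have v: "v \<in> carrier_vec n" using u by (simp add: v_def)
    have "0 < (u @\<^sub>v v) $ i \<and> (W *\<^sub>v (u @\<^sub>v v)) $ i < (u @\<^sub>v v) $ i" if i: "i < n + n" for i
    proof (cases "i < n")
      case True
      have "(C *\<^sub>v v) $ i = (1 + e) * (C *\<^sub>v u) $ i"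
        unfolding v_def using C u True by (subst mult_mat_vec[of _ n n]) auto
      then show ?thesis
        unfolding W_mult[OF u v]
        using True u v B C u_pos[OF True] e[OF True] BC_mult[OF u True]
        by (simp add: algebra_simps)
    next
      case False
      with i have "i - n < n" by simp
      then show ?thesis
        unfolding W_mult[OF u v] using False i u v B C u_pos[of "i - n"] \<open>e > 0\<close>
        by (simp add: v_def algebra_simps add_pos_pos)
    qed
    then show "rho W < 1"
      using u v n by (subst nonneg_rho_less_1_iff[OF W _ W_nonneg]) (auto intro!: bexI[of _ "u @\<^sub>v v"])
  qed
  then show ?thesis by (simp add: W_def)
qed

text \<open>Conjugation by \<open>P\<close> carries one product to the other, so they are similar
  and share their characteristic polynomial.\<close>

lemma rho_mult_minv_commute:
  assumes P: "P \<in> carrier_mat n n" "invertible_mat P" and X: "X \<in> carrier_mat n n"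
  shows "rho (X * minv P) = rho (minv P * X)"
proof (rule rho_cong_char_poly)
  note Q = minv[OF P]
  have "minv P * X = minv P * (X * minv P) * P"
  proof -
    have "minv P * (X * minv P) * P = minv P * (X * (minv P * P))"
      using P(1) Q(1) X by (simp add: assoc_mult_mat[of _ n n _ n _ n] mult_carrier_mat[of _ n n])
    then show ?thesis using Q(3) X by simp
  qed
  then have "similar_mat (minv P * X) (X * minv P)"
    using P(1) Q X by (intro similar_matI[of _ _ "minv P" P n]) auto
  then show "char_poly (X * minv P) = char_poly (minv P * X)"
    by (simp add: char_poly_similar)
  show "X * minv P \<in> carrier_mat n n" "minv P * X \<in> carrier_mat n n"
    using Q(1) X by auto
qed

theorem theorem3p9:
  fixes n :: nat and A P R S :: "real mat"
  assumes "n > 0"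
    and "A \<in> carrier_mat n n"
    and "transpose_mat A = A"
    and "invertible_mat A"
    and "double_weak_splitting_II n A P R S"
  shows "rho (W_tilde n P R S) < 1 \<longleftrightarrow>
    rho ((R - S) * minv P) = rho (minv P * (R - S)) \<and> rho (minv P * (R - S)) < 1"
proof -
  have P: "P \<in> carrier_mat n n" "invertible_mat P"
    and R: "R \<in> carrier_mat n n" and S: "S \<in> carrier_mat n n"
    and RP: "0\<^sub>m n n \<le> R * minv P" and SP: "0\<^sub>m n n \<le> - S * minv P"
    using assms(5) by (auto simp: double_weak_splitting_II_def)
  note Q = minv(1)[OF P]
  define B C where "B = transpose_mat (R * minv P)" and "C = - transpose_mat (S * minv P)"
  have B: "B \<in> carrier_mat n n" and C: "C \<in> carrier_mat n n"
    using R S Q by (auto simp: B_def C_def)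
  have B_nonneg: "0 \<le> B $$ (i, j)" if "i < n" "j < n" for i j
    using that RP R Q by (auto simp: B_def less_eq_mat_def)
  \<comment> \<open>The splitting negates \<open>S\<close> before multiplying, whereas
    \<open>C\<close> negates the product.\<close>
  have SP_minus: "- S * minv P = - (S * minv P)"
    using S Q by simp
  have C_nonneg: "0 \<le> C $$ (i, j)" if "i < n" "j < n" for i j
    using that SP S Q unfolding SP_minus by (auto simp: C_def less_eq_mat_def)
  have "B + C = transpose_mat ((R - S) * minv P)"
  proof -
    have "(R - S) * minv P = R * minv P - S * minv P"
      using R S Q by (simp add: minus_mult_distrib_mat[of _ n n])
    then show ?thesis using R S Q by (auto simp: B_def C_def intro!: eq_matI)
  qed
  then have "rho (B + C) = rho ((R - S) * minv P)"
    using R S Q by (simp add: rho_transpose[of _ n] mult_carrier_mat[of _ n n] minus_carrier_mat)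
  \<comment> \<open>This settles the equality on the right-hand side; the bound is left to the block
    reduction.\<close>
  moreover have "rho ((R - S) * minv P) = rho (minv P * (R - S))"
    using R S by (intro rho_mult_minv_commute[OF P]) auto
  moreover have "rho (W_tilde n P R S) < 1 \<longleftrightarrow> rho (B + C) < 1"
    unfolding W_tilde_def B_def[symmetric] C_def[symmetric]
    using B C assms(1) B_nonneg C_nonneg by (rule rho_block_companion_less_1_iff)
  ultimately show ?thesis by simp
qed

end
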